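(* Let $1\le r\le n$ be integers, let $\mathcal{S}\subset\mathbb{R}^{n\times r}$ be a set containing $\mathbb{S}^{n,r}_+$, let $F:\mathcal{S}\to\mathbb{R}$ be a locally Lipschitz continuous function, and let $p\ge1$ be a constant. Suppose that $0<q_1\le1/2$ and $0<q_2\le1/2$. For any local minimizer $X^*$ of $F$ on $\mathbb{S}^{n,r}_+$, $X^*$ is also a local minimizer of $$\min\left\{F(X)+\mu\left(\|X_-\|_{\ell_p}^{q_1}+\|X^{T}X-I_r\|_{\ell_p}^{q_2}\right):X\in\mathcal{S}\right\}\qquad(\ast)$$ for all $\mu>4L^*\sqrt r\,\max\left\{1,\ (nr)^{\frac{q_1(p-2)}{2p}},\ r^{\frac{q_2(p-2)}{p}}\right\}$, where $L^*$ is a Lipschitz constant of $F$ around $X^*$. Conversely, if $X^*$ lies in $\mathbb{S}^{n,r}_+$ and there exists a constant $\mu$ such that $X^*$ is a local minimizer of $(\ast)$, then $X^*$ is also a local minimizer of $F$ on $\mathbb{S}^{n,r}_+$.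
   Context: $\mathbb{S}^{n,r}_+=\{X\in\mathbb{R}^{n\times r}:X^{T}X=I_r,\ X\ge0\}$ (entry-wise inequality) is the nonnegative Stiefel manifold. For a matrix $Y$, $Y_-=\max\{-Y,0\}$ entry-wise. $\|\cdot\|_F$ is the Frobenius norm; for $p\in[1,\infty)$, $\|\cdot\|_{\ell_p}$ is the entry-wise $\ell_p$-norm of a matrix. The penalty parameter $\mu$ is positive. $F$ is locally Lipschitz continuous on $\mathcal{S}$ if for any $\bar X\in\mathcal{S}$ there exists $L\in(0,\infty)$ such that $|F(X)-F(Y)|\le L\|X-Y\|_F$ for all $X,Y$ in a certain neighborhood of $\bar X$ in $\mathcal{S}$; such an $L$ is called a Lipschitz constant of $F$ around $\bar X$. *)

theory Defs
  imports "HOL-Analysis.Analysis"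
begin

text \<open>
  An \<open>n \<times> r\<close> matrix has type \<^typ>\<open>real ^ 'r ^ 'n\<close>: the row index is outermost, and
  \<open>n = CARD('n)\<close>, \<open>r = CARD('r)\<close>. The library \<^const>\<open>norm\<close> on this type is the \<open>\<ell>\<^sub>2\<close>-norm of
  the \<open>\<ell>\<^sub>2\<close>-norms of the rows, that is, the Frobenius norm, and \<^const>\<open>dist\<close> is the
  Frobenius distance.
\<close>

definition nonneg_stiefel :: "(real ^ 'r ^ 'n) set" where
  "nonneg_stiefel = {X. transpose X ** X = mat 1 \<and> (\<forall>i j. 0 \<le> X $ i $ j)}"

definition neg_part :: "real ^ 'r ^ 'n \<Rightarrow> real ^ 'r ^ 'n" where
  "neg_part X = (\<chi> i j. max (- (X $ i $ j)) 0)"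

definition entry_lp_norm :: "real \<Rightarrow> real ^ 'r ^ 'n \<Rightarrow> real" where
  "entry_lp_norm p X = (\<Sum>i\<in>UNIV. \<Sum>j\<in>UNIV. \<bar>X $ i $ j\<bar> powr p) powr (1 / p)"

text \<open>Functions defined on a set \<open>S\<close> are total functions of which only the values on \<open>S\<close> are used.\<close>

definition lipschitz_const_around ::
    "('a::metric_space \<Rightarrow> real) \<Rightarrow> 'a set \<Rightarrow> 'a \<Rightarrow> real \<Rightarrow> bool" where
  "lipschitz_const_around F S x L \<longleftrightarrow> 0 < L \<and> (\<exists>e>0. L-lipschitz_on (S \<inter> ball x e) F)"

definition locally_lipschitz_on :: "'a::metric_space set \<Rightarrow> ('a \<Rightarrow> real) \<Rightarrow> bool" where
  "locally_lipschitz_on S F \<longleftrightarrow> (\<forall>x\<in>S. \<exists>L. lipschitz_const_around F S x L)"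

definition local_minimizer_on ::
    "('a::metric_space \<Rightarrow> real) \<Rightarrow> 'a set \<Rightarrow> 'a \<Rightarrow> bool" where
  "local_minimizer_on f S x \<longleftrightarrow> x \<in> S \<and> (\<exists>e>0. \<forall>y\<in>S \<inter> ball x e. f x \<le> f y)"

text \<open>For \<open>q > 0\<close>, \<^const>\<open>powr\<close> agrees with the usual power at base \<open>0\<close>: \<open>0 powr q = 0\<close>.\<close>

definition penalized ::
    "(real ^ 'r ^ 'n \<Rightarrow> real) \<Rightarrow> real \<Rightarrow> real \<Rightarrow> real \<Rightarrow> real \<Rightarrow> real ^ 'r ^ 'n \<Rightarrow> real" where
  "penalized F p q1 q2 \<mu> X =
     F X + \<mu> * (entry_lp_norm p (neg_part X) powr q1
                + entry_lp_norm p (transpose X ** X - mat 1) powr q2)"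

end

theory Submission
  imports Defs
begin

text \<open>
  The theorem is exact penalization: if near \<open>X\<^sup>*\<close> every \<open>X\<close> is within distance \<open>h X\<close> of some
  feasible \<open>Y\<close>, then \<open>F X\<^sup>* \<le> F Y \<le> F X + L * h X\<close>, and a penalty that dominates \<open>L * h X\<close>
  makes \<open>X\<^sup>*\<close> a local minimizer without constraints. The other direction is immediate,
  because the penalty vanishes on the feasible set.

  So the work is an error bound, \<open>nonneg_stiefel_error_bound\<close>: with \<open>a = \<parallel>X\<^sub>-\<parallel>\<^sub>F\<close> and
  \<open>b = \<parallel>X\<^sup>T X - I\<parallel>\<^sub>F\<close> small, some feasible \<open>Y\<close> satisfies
  \<open>\<parallel>X - Y\<parallel>\<^sub>F \<le> 4 sqrt r (sqrt a + sqrt b)\<close>. A nonnegative matrix has orthogonal columns exactly when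
  each row has at most one nonzero entry, so \<open>Y\<close> is built by truncating \<open>X\<close> to its positive part
  \<open>W\<close>, keeping in each row of \<open>W\<close> only a largest entry, which gives \<open>Z\<close>, and normalizing the columns
  of \<open>Z\<close>. The three errors are controlled as follows.
  \<^item> \<open>\<parallel>X - W\<parallel> = a\<close>.
  \<^item> A discarded entry is at most the entry that is kept, so its square is at most the product of
    two distinct entries of that row. Hence \<open>\<parallel>W - Z\<parallel>\<^sup>2\<close> is at most the sum of the off-diagonal
    entries of \<open>W\<^sup>T W\<close>, which is \<open>\<parallel>W 1\<parallel>\<^sup>2 - \<parallel>W\<parallel>\<^sup>2\<close> (\<open>keep_row_max_error\<close>). This is of order
    \<open>r (a + b)\<close> (\<open>pos_part_excess\<close>). Only here do square roots of \<open>a\<close> and \<open>b\<close> arise.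
  \<^item> Normalization costs at most the total deviation of the squared column lengths of \<open>Z\<close> from \<open>1\<close>
    (\<open>normalize_columns\<close>). That deviation is again of order \<open>r (a + b)\<close>, hence negligible against
    \<open>sqrt (r a) + sqrt (r b)\<close> when \<open>r a\<close> and \<open>r b\<close> are small.

  Finally, \<open>sqrt a \<le> a powr q\<close> for \<open>a \<le> 1\<close> and \<open>q \<le> 1 / 2\<close>, and the powers of \<open>n r\<close> and \<open>r\<close> in the
  threshold for \<open>\<mu>\<close> are the constants of the comparison between the Frobenius and the entrywise
  \<open>\<ell>\<^sub>p\<close> norm (\<open>norm_powr_le_entry_lp_norm\<close>).
\<close>

section \<open>Comparison of the entrywise norms\<close>

text \<open>
  Each \<open>\<bar>x i\<bar>\<close> is at most the \<open>\<ell>\<^sub>p\<close> norm \<open>t\<close>, so the surplus exponent in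
  \<open>\<bar>x i\<bar>\<^sup>2 = \<bar>x i\<bar> powr (2 - p) * \<bar>x i\<bar> powr p\<close> can be estimated by \<open>t\<close>.
\<close>
lemma sqrt_sum_squares_le_lp:
  fixes x :: "'i \<Rightarrow> real"
  assumes "finite I" "1 \<le> p" "p \<le> 2"
  shows "sqrt (\<Sum>i\<in>I. (x i)\<^sup>2) \<le> (\<Sum>i\<in>I. \<bar>x i\<bar> powr p) powr (1 / p)"
proof -
  define s where "s = (\<Sum>i\<in>I. \<bar>x i\<bar> powr p)"
  define t where "t = s powr (1 / p)"
  have s0: "0 \<le> s" unfolding s_def by (intro sum_nonneg) auto
  have t0: "0 \<le> t" by (simp add: t_def)
  have tp: "t powr p = s" using s0 assms by (simp add: t_def powr_powr)
  have xt: "\<bar>x i\<bar> \<le> t" if "i \<in> I" for i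
  proof -
    have "\<bar>x i\<bar> powr p \<le> s" unfolding s_def using assms that by (intro member_le_sum) auto
    then have "(\<bar>x i\<bar> powr p) powr (1 / p) \<le> t" unfolding t_def using assms by (intro powr_mono2) auto
    then show ?thesis using assms by (simp add: powr_powr)
  qed
  have "(\<Sum>i\<in>I. (x i)\<^sup>2) \<le> (\<Sum>i\<in>I. t powr (2 - p) * \<bar>x i\<bar> powr p)"
  proof (intro sum_mono)
    fix i assume i: "i \<in> I"
    have "(x i)\<^sup>2 = \<bar>x i\<bar> powr (2 - p) * \<bar>x i\<bar> powr p"
      by (simp flip: powr_add)
    also have "\<dots> \<le> t powr (2 - p) * \<bar>x i\<bar> powr p"
      using xt[OF i] assms by (intro mult_right_mono powr_mono2) auto
    finally show "(x i)\<^sup>2 \<le> t powr (2 - p) * \<bar>x i\<bar> powr p" .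
  qed
  also have "\<dots> = t powr (2 - p) * t powr p"
    by (simp add: tp s_def flip: sum_distrib_left)
  also have "\<dots> = t\<^sup>2" using t0 by (simp flip: powr_add)
  finally show ?thesis using t0 by (simp add: real_le_lsqrt t_def s_def)
qed

text \<open>
  This is the power mean inequality. Concavity of \<open>u powr \<theta>\<close> with \<open>\<theta> = 2 / p\<close>, in the form of
  Young's inequality at the mean \<open>m\<close> of the \<open>\<bar>x i\<bar> powr p\<close>, bounds each square by an affine function
  of \<open>\<bar>x i\<bar> powr p\<close>, and the affine bounds add up exactly.
\<close>
lemma sqrt_sum_squares_le_card_lp:
  fixes x :: "'i \<Rightarrow> real"
  assumes "finite I" "2 \<le> p"
  shows "sqrt (\<Sum>i\<in>I. (x i)\<^sup>2)
    \<le> real (card I) powr ((p - 2) / (2 * p)) * (\<Sum>i\<in>I. \<bar>x i\<bar> powr p) powr (1 / p)"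
proof -
  define s where "s = (\<Sum>i\<in>I. \<bar>x i\<bar> powr p)"
  define N where "N = real (card I)"
  define \<theta> where "\<theta> = 2 / p"
  have s0: "0 \<le> s" unfolding s_def by (intro sum_nonneg) auto
  have th: "0 < \<theta>" "\<theta> \<le> 1" using assms by (auto simp: \<theta>_def)
  show ?thesis
  proof (cases "s = 0")
    case True
    then have "\<forall>i\<in>I. \<bar>x i\<bar> powr p = 0"
      unfolding s_def using assms by (subst (asm) sum_nonneg_eq_0_iff) auto
    then have "\<forall>i\<in>I. x i = 0" by auto
    then show ?thesis by simp
  next
    case False
    then have sp: "0 < s" using s0 by simp
    then have "I \<noteq> {}" unfolding s_def by auto
    then have Np: "0 < N" using assms by (simp add: N_def card_gt_0_iff)
    define m where "m = s / N"
    have mp: "0 < m" using sp Np by (simp add: m_def)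
    have "(x i)\<^sup>2 \<le> m powr \<theta> * (\<theta> * (\<bar>x i\<bar> powr p / m) + (1 - \<theta>))" for i
    proof (cases "x i = 0")
      case True
      then show ?thesis using th by auto
    next
      case False
      define u where "u = \<bar>x i\<bar> powr p / m"
      have u: "0 < u" using False mp by (simp add: u_def)
      have "(x i)\<^sup>2 = (\<bar>x i\<bar> powr p) powr \<theta>"
        using assms by (simp add: powr_powr \<theta>_def)
      also have "\<dots> = (m * u) powr \<theta>" using mp by (simp add: u_def)
      also have "\<dots> = m powr \<theta> * (u powr \<theta> * 1 powr (1 - \<theta>))"
        using mp u by (simp add: powr_mult)
      also have "\<dots> \<le> m powr \<theta> * (\<theta> * u + (1 - \<theta>) * 1)"
        using th u by (intro mult_left_mono Youngs_inequality_0) auto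
      finally show ?thesis by (simp add: u_def)
    qed
    then have "(\<Sum>i\<in>I. (x i)\<^sup>2) \<le> (\<Sum>i\<in>I. m powr \<theta> * (\<theta> * (\<bar>x i\<bar> powr p / m) + (1 - \<theta>)))"
      by (intro sum_mono)
    also have "\<dots> = m powr \<theta> * (\<theta> * (s / m) + N * (1 - \<theta>))"
      by (simp add: s_def N_def sum.distrib flip: sum_distrib_left sum_divide_distrib)
    also have "\<dots> = m powr \<theta> * N" using sp Np by (simp add: m_def algebra_simps)
    also have "\<dots> = N powr (1 - \<theta>) * s powr \<theta>"
      using sp Np by (simp add: m_def powr_divide powr_diff)
    also have "\<dots> = (N powr ((1 - \<theta>) / 2) * s powr (\<theta> / 2))\<^sup>2"
    proof -
      have "(t powr (w / 2))\<^sup>2 = t powr w" for t w :: real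
        by (simp add: power2_eq_square flip: powr_add)
      then show ?thesis by (simp only: power_mult_distrib)
    qed
    also have "(1 - \<theta>) / 2 = (p - 2) / (2 * p)"
      using assms by (simp add: \<theta>_def field_simps)
    also have "\<theta> / 2 = 1 / p" by (simp add: \<theta>_def)
    finally show ?thesis by (simp add: real_le_lsqrt N_def s_def)
  qed
qed

lemma norm_matrix_squared:
  fixes A :: "real ^ 'r ^ 'n"
  shows "(norm A)\<^sup>2 = (\<Sum>i\<in>UNIV. \<Sum>j\<in>UNIV. (A $ i $ j)\<^sup>2)"
  by (simp add: norm_vec_def L2_set_def sum_nonneg)

lemma abs_entry_le_norm:
  fixes A :: "real ^ 'r ^ 'n"
  shows "\<bar>A $ i $ j\<bar> \<le> norm A"
  by (rule order_trans[OF component_le_norm_cart Finite_Cartesian_Product.norm_nth_le])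

text \<open>
  For \<open>p \<le> 2\<close> the factor is \<open>1\<close>, for \<open>p \<ge> 2\<close> it is the power of the number of entries; the
  maximum covers both ranges.
\<close>
lemma norm_powr_le_entry_lp_norm:
  fixes A :: "real ^ 'r ^ 'n"
  assumes "1 \<le> p" "0 < q"
  shows "norm A powr q
    \<le> max 1 ((real CARD('n) * real CARD('r)) powr (q * (p - 2) / (2 * p))) * entry_lp_norm p A powr q"
proof -
  let ?I = "UNIV :: ('n \<times> 'r) set"
  let ?x = "\<lambda>(i, j). A $ i $ j"
  let ?N = "real CARD('n) * real CARD('r)"
  have n: "norm A = sqrt (\<Sum>k\<in>?I. (?x k)\<^sup>2)"
    by (rule sym, rule real_sqrt_unique)
       (simp_all add: norm_matrix_squared sum.cartesian_product split_def)
  have l: "entry_lp_norm p A = (\<Sum>k\<in>?I. \<bar>?x k\<bar> powr p) powr (1 / p)"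
    by (simp add: entry_lp_norm_def sum.cartesian_product split_def)
  have c: "real (card ?I) = ?N" by (simp flip: UNIV_Times_UNIV add: card_cartesian_product)
  show ?thesis
  proof (cases "p \<le> 2")
    case True
    have "norm A powr q \<le> 1 * entry_lp_norm p A powr q"
      unfolding n l using sqrt_sum_squares_le_lp[of ?I p ?x] assms True
      by (simp add: powr_mono2 sum_nonneg)
    also have "\<dots> \<le> max 1 (?N powr (q * (p - 2) / (2 * p))) * entry_lp_norm p A powr q"
      by (intro mult_right_mono) auto
    finally show ?thesis .
  next
    case False
    have "norm A \<le> ?N powr ((p - 2) / (2 * p)) * entry_lp_norm p A"
      unfolding n l using sqrt_sum_squares_le_card_lp[of ?I p ?x] False c by simp
    then have "norm A powr q \<le> (?N powr ((p - 2) / (2 * p)) * entry_lp_norm p A) powr q"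
      using assms by (intro powr_mono2) auto
    also have "\<dots> = ?N powr (q * (p - 2) / (2 * p)) * entry_lp_norm p A powr q"
      by (simp add: powr_mult powr_powr entry_lp_norm_def mult.commute)
    also have "\<dots> \<le> max 1 (?N powr (q * (p - 2) / (2 * p))) * entry_lp_norm p A powr q"
      by (intro mult_right_mono) auto
    finally show ?thesis .
  qed
qed

section \<open>Rounding to the nonnegative Stiefel manifold\<close>

lemma norm_matrix_vector_le:
  fixes A :: "real ^ 'm ^ 'n"
  shows "norm (A *v x) \<le> norm A * norm x"
proof -
  have "norm (A *v x) = L2_set (\<lambda>i. norm (A $ i \<bullet> x)) UNIV"
    by (simp add: norm_vec_def matrix_vector_mult_def inner_vec_def)
  also have "\<dots> \<le> L2_set (\<lambda>i. norm (A $ i) * norm x) UNIV"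
    using Cauchy_Schwarz_ineq2 by (intro L2_set_mono) auto
  also have "\<dots> = norm A * norm x"
    by (simp add: norm_vec_def[of A] L2_set_left_distrib)
  finally show ?thesis .
qed

lemma norm_matrix_vector_squared:
  fixes X :: "real ^ 'r ^ 'n"
  shows "(norm (X *v x))\<^sup>2 = x \<bullet> ((transpose X ** X) *v x)"
  by (simp add: power2_norm_eq_inner matrix_vector_mul_assoc[symmetric] transpose_matrix_vector
      inner_commute flip: dot_lmul_matrix)

lemma gram_nth:
  fixes X :: "real ^ 'r ^ 'n"
  shows "(transpose X ** X) $ k $ l = (\<Sum>i\<in>UNIV. X $ i $ k * X $ i $ l)"
  by (simp add: matrix_matrix_mult_def transpose_def)

lemma norm_one_vec: "norm (1 :: real ^ 'r) = sqrt (real CARD('r))"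
  by (simp add: norm_vec_def L2_set_def)

definition keep_column :: "('n \<Rightarrow> 'r) \<Rightarrow> real ^ 'r ^ 'n \<Rightarrow> real ^ 'r ^ 'n" where
  "keep_column g W = (\<chi> i j. if j = g i then W $ i $ j else 0)"

text \<open>
  With \<open>v\<close> the sum of a row \<open>w\<close>, the right-hand side is the sum over the rows of all
  \<open>w k * (v - w k)\<close>. If \<open>k\<close> is discarded, then \<open>v - w k\<close> contains the largest entry of the row,
  so \<open>w k * (v - w k)\<close> is at least \<open>(w k)\<^sup>2\<close>, the squared error at \<open>k\<close>.
\<close>
lemma keep_row_max_error:
  fixes W :: "real ^ 'r ^ 'n"
  assumes nn: "\<And>i j. 0 \<le> W $ i $ j" and g: "\<And>i k. W $ i $ k \<le> W $ i $ g i"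
  shows "(norm (W - keep_column g W))\<^sup>2 \<le> (norm (W *v 1))\<^sup>2 - (norm W)\<^sup>2"
proof -
  let ?v = "\<lambda>i. \<Sum>l\<in>UNIV. W $ i $ l"
  have "(W $ i $ k - keep_column g W $ i $ k)\<^sup>2 \<le> W $ i $ k * (?v i - W $ i $ k)" for i k
  proof (cases "k = g i")
    case True
    have "W $ i $ k \<le> ?v i" using nn by (intro member_le_sum) auto
    then show ?thesis using True nn by (simp add: keep_column_def)
  next
    case False
    have "(\<Sum>l\<in>{k, g i}. W $ i $ l) \<le> ?v i" using nn by (intro sum_mono2) auto
    then have "W $ i $ k \<le> ?v i - W $ i $ k" using False g[of i k] by simp
    then have "W $ i $ k * W $ i $ k \<le> W $ i $ k * (?v i - W $ i $ k)"
      using nn by (intro mult_left_mono) auto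
    then show ?thesis using False by (simp add: keep_column_def power2_eq_square)
  qed
  then have "(norm (W - keep_column g W))\<^sup>2 \<le> (\<Sum>i\<in>UNIV. \<Sum>k\<in>UNIV. W $ i $ k * (?v i - W $ i $ k))"
    unfolding norm_matrix_squared by (intro sum_mono) simp
  also have "\<dots> = (\<Sum>i\<in>UNIV. (?v i)\<^sup>2) - (norm W)\<^sup>2"
    unfolding norm_matrix_squared
    by (simp add: right_diff_distrib sum_subtractf power2_eq_square flip: sum_distrib_right)
  also have "(\<Sum>i\<in>UNIV. (?v i)\<^sup>2) = (norm (W *v 1))\<^sup>2"
    by (simp add: norm_vec_def L2_set_def sum_nonneg matrix_vector_mult_def)
  finally show ?thesis .
qed

text \<open>
  Rescaling a column of squared length \<open>c\<close> to a unit vector moves it by \<open>\<bar>sqrt c - 1\<bar>\<close>, which is at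
  most \<open>\<bar>c - 1\<bar> = \<bar>sqrt c - 1\<bar> * (sqrt c + 1)\<close>.
\<close>
lemma normalize_columns:
  fixes Z :: "real ^ 'r ^ 'n"
  assumes nn: "\<And>i j. 0 \<le> Z $ i $ j"
    and orth: "\<And>i k l. k \<noteq> l \<Longrightarrow> Z $ i $ k * Z $ i $ l = 0"
    and pos: "\<And>j. 0 < (\<Sum>i\<in>UNIV. (Z $ i $ j)\<^sup>2)"
  shows "\<exists>Y\<in>nonneg_stiefel. norm (Z - Y) \<le> (\<Sum>j\<in>UNIV. \<bar>(\<Sum>i\<in>UNIV. (Z $ i $ j)\<^sup>2) - 1\<bar>)"
proof -
  define c where "c j = (\<Sum>i\<in>UNIV. (Z $ i $ j)\<^sup>2)" for j
  define Y :: "real ^ 'r ^ 'n" where "Y = (\<chi> i j. Z $ i $ j / sqrt (c j))"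
  have cp: "0 < c j" for j using pos by (simp add: c_def)
  have "(transpose Y ** Y) $ k $ l = mat 1 $ k $ l" for k l
  proof (cases "k = l")
    case True
    have "(transpose Y ** Y) $ k $ k = (\<Sum>i\<in>UNIV. (Z $ i $ k)\<^sup>2 / c k)"
      using cp[of k] by (simp add: gram_nth Y_def power2_eq_square)
    also have "\<dots> = 1" using cp[of k] by (simp add: c_def flip: sum_divide_distrib)
    finally show ?thesis using True by (simp add: mat_def)
  next
    case False
    have "Y $ i $ k * Y $ i $ l = 0" for i
      using orth[OF False, of i] by (auto simp: Y_def)
    then show ?thesis using False by (simp only: gram_nth) (simp add: mat_def)
  qed
  then have "Y \<in> nonneg_stiefel"
    using nn cp by (simp add: nonneg_stiefel_def vec_eq_iff Y_def less_imp_le)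
  moreover have "norm (Z - Y) \<le> (\<Sum>j\<in>UNIV. \<bar>c j - 1\<bar>)"
  proof -
    have col: "(\<Sum>i\<in>UNIV. ((Z - Y) $ i $ j)\<^sup>2) = (sqrt (c j) - 1)\<^sup>2" for j
    proof -
      have "(\<Sum>i\<in>UNIV. ((Z - Y) $ i $ j)\<^sup>2) = (\<Sum>i\<in>UNIV. (Z $ i $ j)\<^sup>2 * (1 - 1 / sqrt (c j))\<^sup>2)"
        by (simp add: Y_def algebra_simps flip: power_mult_distrib)
      also have "\<dots> = (sqrt (c j))\<^sup>2 * (1 - 1 / sqrt (c j))\<^sup>2"
        using cp[of j] by (simp flip: sum_distrib_right c_def)
      also have "\<dots> = (sqrt (c j) * (1 - 1 / sqrt (c j)))\<^sup>2"
        by (simp only: power_mult_distrib)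
      also have "sqrt (c j) * (1 - 1 / sqrt (c j)) = sqrt (c j) - 1"
        using cp[of j] by (simp add: right_diff_distrib)
      finally show ?thesis .
    qed
    have "norm (Z - Y) = L2_set (\<lambda>j. sqrt (c j) - 1) UNIV"
      unfolding L2_set_def
      by (rule sym, rule real_sqrt_unique)
         (simp_all only: norm_matrix_squared, subst sum.swap, simp_all only: col norm_ge_zero)
    also have "\<dots> \<le> (\<Sum>j\<in>UNIV. \<bar>sqrt (c j) - 1\<bar>)" by (rule L2_set_le_sum_abs)
    also have "\<dots> \<le> (\<Sum>j\<in>UNIV. \<bar>c j - 1\<bar>)"
    proof (intro sum_mono)
      fix j
      have s: "0 < sqrt (c j)" "c j = (sqrt (c j))\<^sup>2" using cp[of j] by auto
      have "\<bar>sqrt (c j) - 1\<bar> * 1 \<le> \<bar>sqrt (c j) - 1\<bar> * \<bar>sqrt (c j) + 1\<bar>"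
        using s(1) by (intro mult_left_mono) auto
      also have "\<dots> = \<bar>(sqrt (c j))\<^sup>2 - 1\<bar>"
        by (simp add: abs_mult[symmetric] power2_eq_square algebra_simps)
      finally show "\<bar>sqrt (c j) - 1\<bar> \<le> \<bar>c j - 1\<bar>" using s(2) by simp
    qed
    finally show ?thesis .
  qed
  ultimately show ?thesis unfolding c_def by blast
qed

definition pos_part :: "real ^ 'r ^ 'n \<Rightarrow> real ^ 'r ^ 'n" where
  "pos_part X = (\<chi> i j. max (X $ i $ j) 0)"

lemma pos_part_eq: "pos_part X = X + neg_part X"
  by (simp add: pos_part_def neg_part_def vec_eq_iff max_def)

lemma square_pos_neg_part:
  "(pos_part X $ i $ j)\<^sup>2 + (neg_part X $ i $ j)\<^sup>2 = (X $ i $ j)\<^sup>2"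
  by (simp add: pos_part_def neg_part_def max_def)

text \<open>
  If \<open>X\<^sup>T X = I\<close> and \<open>X \<ge> 0\<close>, both \<open>\<parallel>W 1\<parallel>\<^sup>2\<close> and \<open>\<parallel>W\<parallel>\<^sup>2\<close> are equal to \<open>r\<close>. In general
  \<open>\<parallel>X 1\<parallel>\<^sup>2\<close> and \<open>\<parallel>X\<parallel>\<^sup>2\<close>, which are the sum of all entries and the trace of \<open>X\<^sup>T X\<close>, each differ
  from \<open>r\<close> by at most \<open>r b\<close>, and passing from \<open>X\<close> to its positive part changes them by \<open>O(r a)\<close>.
  Estimating \<open>\<parallel>X 1\<parallel>\<close> as a whole, instead of column by column, keeps the factor at \<open>r\<close>,
  and so the factor in the error bound at \<open>sqrt r\<close>.
\<close>
lemma pos_part_excess: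
  fixes X :: "real ^ 'r ^ 'n"
  defines "a \<equiv> norm (neg_part X)" and "b \<equiv> norm (transpose X ** X - mat 1)"
    and "r \<equiv> real CARD('r)"
  assumes a1: "a \<le> 1 / 25" and b1: "b \<le> 1 / 25"
  shows "(norm (pos_part X *v 1))\<^sup>2 - (norm (pos_part X))\<^sup>2 \<le> 2 * r * b + 4 * r * a"
proof -
  let ?E = "transpose X ** X - mat 1"
  have r1: "1 \<le> r" by (simp add: r_def Suc_leI)
  have a0: "0 \<le> a" and b0: "0 \<le> b" by (simp_all add: a_def b_def)
  have n1: "norm (1 :: real ^ 'r) * norm (1 :: real ^ 'r) = r"
    by (simp add: norm_one_vec r_def)
  have gram: "transpose X ** X = mat 1 + ?E" by simp
  have X1: "(norm (X *v 1))\<^sup>2 \<le> r + r * b"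
  proof -
    have "(norm (X *v 1))\<^sup>2 = (1 :: real ^ 'r) \<bullet> 1 + 1 \<bullet> (?E *v 1)"
      by (subst norm_matrix_vector_squared, subst gram)
         (simp only: matrix_vector_mult_add_rdistrib inner_add_right matrix_vector_mul_lid)
    moreover have "(1 :: real ^ 'r) \<bullet> 1 = r" by (simp add: n1 dot_square_norm power2_eq_square)
    moreover have "1 \<bullet> (?E *v 1) \<le> norm (1 :: real ^ 'r) * (b * norm (1 :: real ^ 'r))"
      unfolding b_def
      by (rule order_trans[OF norm_cauchy_schwarz], intro mult_left_mono norm_matrix_vector_le) auto
    moreover have "norm (1 :: real ^ 'r) * (b * norm (1 :: real ^ 'r)) = r * b"
      using n1 by (simp add: mult.left_commute mult.commute)
    ultimately show ?thesis by linarith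
  qed
  have N1: "norm (neg_part X *v 1) \<le> a * sqrt r"
    unfolding a_def r_def norm_one_vec[symmetric] by (rule norm_matrix_vector_le)
  have X1': "norm (X *v 1) \<le> 11 / 10 * sqrt r"
  proof (rule power2_le_imp_le)
    have "r * b \<le> r * (1 / 25)" using b1 r1 by (intro mult_left_mono) auto
    then have "(norm (X *v 1))\<^sup>2 \<le> 121 / 100 * r" using X1 r1 by linarith
    then show "(norm (X *v 1))\<^sup>2 \<le> (11 / 10 * sqrt r)\<^sup>2"
      using r1 by (simp add: power_mult_distrib power_divide)
  qed (use r1 in simp)
  have W1: "(norm (pos_part X *v 1))\<^sup>2 \<le> r + r * b + 22 / 10 * (r * a) + r * a\<^sup>2"
  proof -
    have "norm (pos_part X *v 1) \<le> norm (X *v 1) + norm (neg_part X *v 1)"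
      unfolding pos_part_eq matrix_vector_mult_add_rdistrib by (rule norm_triangle_ineq)
    then have "(norm (pos_part X *v 1))\<^sup>2 \<le> (norm (X *v 1) + norm (neg_part X *v 1))\<^sup>2"
      by (intro power_mono) auto
    also have "\<dots> = (norm (X *v 1))\<^sup>2 + 2 * (norm (X *v 1) * norm (neg_part X *v 1))
        + (norm (neg_part X *v 1))\<^sup>2"
      by (simp add: power2_sum)
    also have "\<dots> \<le> (r + r * b) + 2 * ((11 / 10 * sqrt r) * (a * sqrt r)) + (a * sqrt r)\<^sup>2"
      using X1 X1' N1 r1 by (intro add_mono mult_left_mono mult_mono power_mono) auto
    also have "(11 / 10 * sqrt r) * (a * sqrt r) = 11 / 10 * (r * a)"
      using r1 by simp
    also have "(a * sqrt r)\<^sup>2 = r * a\<^sup>2" using r1 by (simp add: power_mult_distrib)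
    finally show ?thesis by (simp add: mult.commute)
  qed
  have W2: "r - r * b - a\<^sup>2 \<le> (norm (pos_part X))\<^sup>2"
  proof -
    have "(norm X)\<^sup>2 = (\<Sum>j\<in>UNIV. (transpose X ** X) $ j $ j)"
      unfolding norm_matrix_squared gram_nth by (subst sum.swap) (simp add: power2_eq_square)
    also have "\<dots> \<ge> (\<Sum>j\<in>(UNIV :: 'r set). 1 - b)"
    proof (intro sum_mono)
      fix j
      have "\<bar>?E $ j $ j\<bar> \<le> b"
        unfolding b_def by (rule abs_entry_le_norm)
      then show "1 - b \<le> (transpose X ** X) $ j $ j" by (simp add: mat_def abs_le_iff)
    qed
    finally have "r - r * b \<le> (norm X)\<^sup>2" by (simp add: r_def algebra_simps)
    moreover have "(norm X)\<^sup>2 = (norm (pos_part X))\<^sup>2 + a\<^sup>2"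
      by (simp add: a_def norm_matrix_squared square_pos_neg_part flip: sum.distrib)
    ultimately show ?thesis by linarith
  qed
  have "a\<^sup>2 \<le> a * (1 / 25)" unfolding power2_eq_square using a1 a0 by (intro mult_left_mono) auto
  then have a2: "a\<^sup>2 \<le> a / 25" by simp
  have "r * a\<^sup>2 \<le> r * (a / 25)" using a2 r1 by (intro mult_left_mono) auto
  moreover have "1 * a \<le> r * a" using r1 a0 by (intro mult_right_mono) auto
  moreover have "0 \<le> r * a" using r1 a0 by simp
  ultimately show ?thesis using W1 W2 a2 by simp
qed

text \<open>
  The threshold \<open>1 / (25 r)\<close> serves two purposes: it keeps the columns of \<open>Z\<close> nonzero, and it gives
  \<open>r a \<le> sqrt (r a) / 5\<close>, so that the cost \<open>3 r b + 5 r a\<close> of the normalization is at most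
  \<open>sqrt (r a) + sqrt (r b)\<close>.
\<close>
lemma nonneg_stiefel_error_bound:
  fixes X :: "real ^ 'r ^ 'n"
  defines "a \<equiv> norm (neg_part X)" and "b \<equiv> norm (transpose X ** X - mat 1)"
    and "r \<equiv> real CARD('r)"
  assumes a1: "a \<le> 1 / (25 * r)" and b1: "b \<le> 1 / (25 * r)"
  shows "\<exists>Y\<in>nonneg_stiefel. norm (X - Y) \<le> 4 * sqrt r * (sqrt a + sqrt b)"
proof -
  define W where "W = pos_part X"
  have "\<exists>k. \<forall>l. W $ i $ l \<le> W $ i $ k" for i
  proof -
    have "Max (range (($) (W $ i))) \<in> range (($) (W $ i))" by (intro Max_in) auto
    then obtain k where "Max (range (($) (W $ i))) = W $ i $ k" by (rule imageE)
    then show ?thesis by (metis Max_ge finite finite_imageI rangeI)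
  qed
  then obtain g where g: "\<And>i l. W $ i $ l \<le> W $ i $ g i" by metis
  define Z where "Z = keep_column g W"
  define c where "c j = (\<Sum>i\<in>UNIV. (Z $ i $ j)\<^sup>2)" for j
  define d where "d = (norm (W - Z))\<^sup>2"
  have r1: "1 \<le> r" by (simp add: r_def Suc_leI)
  have a0: "0 \<le> a" and b0: "0 \<le> b" by (simp_all add: a_def b_def)
  have ra: "r * a \<le> 1 / 25" "r * b \<le> 1 / 25" using a1 b1 r1 by (simp_all add: field_simps)
  have "1 * a \<le> r * a" "1 * b \<le> r * b" using r1 a0 b0 by (intro mult_right_mono; simp)+
  then have ale: "a \<le> r * a" "b \<le> r * b" by simp_all
  have a2: "a\<^sup>2 \<le> r * a"
  proof -
    have "a * a \<le> a * 1" using a0 ale ra by (intro mult_left_mono) auto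
    then show ?thesis using ale by (simp add: power2_eq_square)
  qed
  have Wnn: "0 \<le> W $ i $ j" for i j by (simp add: W_def pos_part_def)
  have d: "d \<le> 2 * r * b + 4 * r * a"
  proof -
    have "d \<le> (norm (W *v 1))\<^sup>2 - (norm W)\<^sup>2"
      unfolding d_def Z_def using Wnn g by (rule keep_row_max_error)
    also have "\<dots> \<le> 2 * r * b + 4 * r * a"
      unfolding W_def a_def b_def r_def
      by (rule pos_part_excess) (use ale ra in \<open>simp_all add: a_def b_def\<close>)
    finally show ?thesis .
  qed
  have cdev: "(\<Sum>j\<in>UNIV. \<bar>c j - 1\<bar>) \<le> 3 * r * b + 5 * r * a"
  proof -
    let ?E = "transpose X ** X - mat 1"
    have "\<bar>c j - 1\<bar> \<le> b + (\<Sum>i\<in>UNIV. (neg_part X $ i $ j)\<^sup>2) + (\<Sum>i\<in>UNIV. ((W - Z) $ i $ j)\<^sup>2)" for j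
    proof -
      have "(\<Sum>i\<in>UNIV. (X $ i $ j)\<^sup>2) = 1 + ?E $ j $ j"
        by (simp add: gram_nth mat_def power2_eq_square)
      moreover have "(\<Sum>i\<in>UNIV. (X $ i $ j)\<^sup>2)
          = (\<Sum>i\<in>UNIV. (W $ i $ j)\<^sup>2) + (\<Sum>i\<in>UNIV. (neg_part X $ i $ j)\<^sup>2)"
        by (simp add: W_def square_pos_neg_part flip: sum.distrib)
      \<comment> \<open>Entrywise, one of \<open>Z\<close> and \<open>W - Z\<close> vanishes.\<close>
      moreover have "(\<Sum>i\<in>UNIV. (W $ i $ j)\<^sup>2) = c j + (\<Sum>i\<in>UNIV. ((W - Z) $ i $ j)\<^sup>2)"
        unfolding c_def sum.distrib[symmetric]
        by (intro sum.cong) (auto simp: Z_def keep_column_def)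
      moreover have "\<bar>?E $ j $ j\<bar> \<le> b"
        unfolding b_def by (rule abs_entry_le_norm)
      moreover have "0 \<le> (\<Sum>i\<in>UNIV. (neg_part X $ i $ j)\<^sup>2)" "0 \<le> (\<Sum>i\<in>UNIV. ((W - Z) $ i $ j)\<^sup>2)"
        by (intro sum_nonneg; simp)+
      ultimately show ?thesis by linarith
    qed
    then have "(\<Sum>j\<in>UNIV. \<bar>c j - 1\<bar>) \<le> (\<Sum>j\<in>UNIV. b + (\<Sum>i\<in>UNIV. (neg_part X $ i $ j)\<^sup>2)
        + (\<Sum>i\<in>UNIV. ((W - Z) $ i $ j)\<^sup>2))"
      by (intro sum_mono)
    also have "\<dots> = r * b + (\<Sum>j\<in>UNIV. \<Sum>i\<in>UNIV. (neg_part X $ i $ j)\<^sup>2)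
        + (\<Sum>j\<in>UNIV. \<Sum>i\<in>UNIV. ((W - Z) $ i $ j)\<^sup>2)"
      by (simp only: sum.distrib) (simp add: r_def)
    also have "(\<Sum>j\<in>UNIV. \<Sum>i\<in>UNIV. (neg_part X $ i $ j)\<^sup>2) = a\<^sup>2"
      unfolding a_def norm_matrix_squared by (rule sum.swap)
    also have "(\<Sum>j\<in>UNIV. \<Sum>i\<in>UNIV. ((W - Z) $ i $ j)\<^sup>2) = d"
      unfolding d_def norm_matrix_squared by (rule sum.swap)
    finally show ?thesis using d a2 by simp
  qed
  have "0 < c j" for j
  proof -
    have "\<bar>c j - 1\<bar> \<le> (\<Sum>j\<in>UNIV. \<bar>c j - 1\<bar>)" by (rule member_le_sum) auto
    then show ?thesis using cdev ra by linarith
  qed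
  moreover have "0 \<le> Z $ i $ j" for i j using Wnn by (simp add: Z_def keep_column_def)
  moreover have "Z $ i $ k * Z $ i $ l = 0" if "k \<noteq> l" for i k l
    using that by (auto simp: Z_def keep_column_def)
  ultimately obtain Y
    where Y: "Y \<in> nonneg_stiefel" "norm (Z - Y) \<le> (\<Sum>j\<in>UNIV. \<bar>c j - 1\<bar>)"
    using normalize_columns[of Z] unfolding c_def by blast
  have lin: "r * t \<le> sqrt r * sqrt t / 5" if "0 \<le> t" "r * t \<le> 1 / 25" for t
  proof -
    have "sqrt (r * t) \<le> sqrt (1 / 25)" using that by (intro real_sqrt_le_mono)
    then have "sqrt (r * t) \<le> 1 / 5" by (simp add: real_sqrt_divide real_sqrt_unique[of 5 25])
    then have "sqrt (r * t) * sqrt (r * t) \<le> sqrt (r * t) * (1 / 5)"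
      using that r1 by (intro mult_left_mono) auto
    moreover have "sqrt (r * t) * sqrt (r * t) = r * t" using that r1 by simp
    ultimately show ?thesis by (simp add: real_sqrt_mult)
  qed
  define \<alpha> \<beta> where "\<alpha> = sqrt r * sqrt a" and "\<beta> = sqrt r * sqrt b"
  have ab0: "0 \<le> \<alpha>" "0 \<le> \<beta>" using r1 a0 b0 by (simp_all add: \<alpha>_def \<beta>_def)
  have "norm (W - Z) \<le> 2 * \<alpha> + 2 * \<beta>"
  proof (rule power2_le_imp_le)
    have "2 * r * b + 4 * r * a = 4 * \<alpha>\<^sup>2 + 2 * \<beta>\<^sup>2"
      using r1 a0 b0 by (simp add: \<alpha>_def \<beta>_def power_mult_distrib)
    also have "\<dots> \<le> (2 * \<alpha> + 2 * \<beta>)\<^sup>2"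
      using ab0 by (simp add: power2_sum power_mult_distrib)
    finally show "(norm (W - Z))\<^sup>2 \<le> (2 * \<alpha> + 2 * \<beta>)\<^sup>2" using d by (simp add: d_def)
  qed (use ab0 in simp)
  moreover have "norm (Z - Y) \<le> \<alpha> + \<beta>"
    using Y(2) cdev lin[OF a0 ra(1)] lin[OF b0 ra(2)] ab0 by (simp add: \<alpha>_def \<beta>_def)
  moreover have "norm (X - W) \<le> \<alpha>"
  proof -
    have "norm (X - W) = a" by (simp add: W_def pos_part_eq a_def)
    also have "\<dots> \<le> \<alpha>" using ale(1) lin[OF a0 ra(1)] ab0 by (simp add: \<alpha>_def)
    finally show ?thesis .
  qed
  moreover have "norm (X - Y) \<le> norm (X - W) + norm (W - Z) + norm (Z - Y)"
    using norm_triangle_ineq[of "X - W + (W - Z)" "Z - Y"] norm_triangle_ineq[of "X - W" "W - Z"]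
    by simp
  ultimately have "norm (X - Y) \<le> 4 * \<alpha> + 4 * \<beta>" using ab0 by linarith
  then show ?thesis using Y(1) by (intro bexI[of _ Y]) (simp_all add: \<alpha>_def \<beta>_def algebra_simps)
qed

section \<open>Exactness of the penalty\<close>

lemma penalized_eq_on_stiefel:
  assumes "X \<in> nonneg_stiefel"
  shows "penalized F p q1 q2 \<mu> X = F X"
proof -
  have "neg_part X = 0" using assms by (simp add: nonneg_stiefel_def neg_part_def vec_eq_iff)
  then show ?thesis
    using assms by (simp add: nonneg_stiefel_def penalized_def entry_lp_norm_def)
qed

lemma sqrt_le_powr:
  fixes t :: real
  assumes "0 \<le> t" "t \<le> 1" "q \<le> 1 / 2"
  shows "sqrt t \<le> t powr q"
  using assms powr_mono'[of q "1/2" t] by (simp add: powr_half_sqrt)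

lemma isCont_norm_neg_part: "isCont (\<lambda>X. norm (neg_part X)) X"
  unfolding isCont_def neg_part_def by (intro tendsto_intros)

lemma isCont_norm_gram: "isCont (\<lambda>X. norm (transpose X ** X - mat 1 :: real ^ 'r ^ 'r)) (X :: real ^ 'r ^ 'n)"
  unfolding isCont_def matrix_matrix_mult_def transpose_def by (simp, intro tendsto_intros)

theorem theorem11:
  fixes S :: "(real ^ 'r ^ 'n) set"
    and F :: "real ^ 'r ^ 'n \<Rightarrow> real"
    and p q1 q2 :: real
  assumes "CARD('r) \<le> CARD('n)"
    and "nonneg_stiefel \<subseteq> S"
    and "locally_lipschitz_on S F"
    and "1 \<le> p"
    and "0 < q1" and "q1 \<le> 1 / 2"
    and "0 < q2" and "q2 \<le> 1 / 2"
  shows "(\<forall>X L \<mu>. local_minimizer_on F nonneg_stiefel X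
            \<longrightarrow> lipschitz_const_around F S X L
            \<longrightarrow> \<mu> > 4 * L * sqrt (real CARD('r))
                   * Max {1,
                          (real CARD('n) * real CARD('r)) powr (q1 * (p - 2) / (2 * p)),
                          real CARD('r) powr (q2 * (p - 2) / p)}
            \<longrightarrow> local_minimizer_on (penalized F p q1 q2 \<mu>) S X)
       \<and> (\<forall>X \<in> nonneg_stiefel.
            (\<exists>\<mu>>0. local_minimizer_on (penalized F p q1 q2 \<mu>) S X)
            \<longrightarrow> local_minimizer_on F nonneg_stiefel X)"
proof (intro conjI allI impI ballI)
  fix X :: "real ^ 'r ^ 'n" and L \<mu> :: real
  let ?r = "real CARD('r)"
  let ?N = "real CARD('n) * ?r"
  let ?M = "Max {1, ?N powr (q1 * (p - 2) / (2 * p)), ?r powr (q2 * (p - 2) / p)}"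
  assume min: "local_minimizer_on F nonneg_stiefel X"
    and lip: "lipschitz_const_around F S X L"
    and \<mu>: "\<mu> > 4 * L * sqrt ?r * ?M"
  from min obtain e1 where X: "X \<in> nonneg_stiefel" and e1: "0 < e1"
    and min': "\<And>Y. Y \<in> nonneg_stiefel \<Longrightarrow> dist X Y < e1 \<Longrightarrow> F X \<le> F Y"
    by (auto simp: local_minimizer_on_def)
  from lip obtain e2 where L: "0 < L" and e2: "0 < e2" and lip': "L-lipschitz_on (S \<inter> ball X e2) F"
    by (auto simp: lipschitz_const_around_def)
  define a where "a Y = norm (neg_part Y)" for Y :: "real ^ 'r ^ 'n"
  define b where "b Y = norm (transpose Y ** Y - mat 1)" for Y :: "real ^ 'r ^ 'n"
  define h where "h Y = 4 * sqrt ?r * (sqrt (a Y) + sqrt (b Y))" for Y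
  have cont: "isCont a X" "isCont b X"
    unfolding a_def b_def by (rule isCont_norm_neg_part isCont_norm_gram)+
  have conth: "isCont h X" unfolding h_def using cont by (intro continuous_intros)
  have aX: "a X = 0" and bX: "b X = 0"
    using X by (simp_all add: a_def b_def nonneg_stiefel_def neg_part_def vec_eq_iff)
  have hX: "h X = 0" by (simp add: h_def aX bX)
  \<comment> \<open>Half of the radius is for the distance from \<open>X\<close> to a competitor, half for the distance
    from there to the feasible point that approximates it.\<close>
  define e where "e = min e1 e2 / 2"
  have e: "0 < e" using e1 e2 by (simp add: e_def)
  have r0: "0 < 1 / (25 * ?r)" by simp
  have ev: "\<forall>\<^sub>F Y in nhds X. a Y < 1 / (25 * ?r) \<and> b Y < 1 / (25 * ?r) \<and> h Y < e \<and> dist X Y < e"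
    by (intro eventually_conj order_tendstoD(2)[OF cont(1)[unfolded isCont_def tendsto_at_iff_tendsto_nhds]] 
        order_tendstoD(2)[OF cont(2)[unfolded isCont_def tendsto_at_iff_tendsto_nhds]] 
        order_tendstoD(2)[OF conth[unfolded isCont_def tendsto_at_iff_tendsto_nhds]])
       (use r0 e aX bX hX in \<open>auto simp: eventually_nhds_metric dist_commute\<close>)
  then obtain \<delta> where \<delta>: "0 < \<delta>" and near: "\<And>Y. dist X Y < \<delta> \<Longrightarrow>
      a Y < 1 / (25 * ?r) \<and> b Y < 1 / (25 * ?r) \<and> h Y < e \<and> dist X Y < e"
    unfolding eventually_nhds_metric by (metis dist_commute)
  have "penalized F p q1 q2 \<mu> X \<le> penalized F p q1 q2 \<mu> Y" if Y: "Y \<in> S" "dist X Y < \<delta>" for Y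
  proof -
    have small: "a Y < 1 / (25 * ?r)" "b Y < 1 / (25 * ?r)" "h Y < e" "dist X Y < e"
      using near[OF Y(2)] by auto
    obtain Z where Z: "Z \<in> nonneg_stiefel" "norm (Y - Z) \<le> h Y"
      using nonneg_stiefel_error_bound[of Y] small(1,2) unfolding a_def b_def h_def by auto
    have "dist X Z \<le> dist X Y + norm (Y - Z)" by (metis dist_norm dist_triangle)
    then have XZ: "dist X Z < 2 * e" using Z(2) small(3,4) by linarith
    have "F X \<le> F Z" using min' Z(1) XZ by (simp add: e_def)
    also have "F Z \<le> F Y + L * norm (Y - Z)"
    proof -
      have "dist (F Z) (F Y) \<le> L * dist Z Y"
        using lip' Z(1) Y(1) XZ small(4) e assms(2)
        by (intro lipschitz_onD[OF lip']) (auto simp: e_def)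
      then show ?thesis by (simp add: dist_norm norm_minus_commute)
    qed
    also have "\<dots> \<le> F Y + L * h Y" using Z(2) L by simp
    also have "L * h Y \<le> \<mu> * (entry_lp_norm p (neg_part Y) powr q1
        + entry_lp_norm p (transpose Y ** Y - mat 1) powr q2)" (is "_ \<le> \<mu> * (?u + ?v)")
    proof -
      have "1 / (25 * ?r) \<le> 1 / 25" by (intro divide_left_mono) (auto simp: Suc_leI)
      then have le1: "a Y \<le> 1" "b Y \<le> 1" using small by linarith+
      have "sqrt (a Y) \<le> a Y powr q1"
        using le1 assms by (intro sqrt_le_powr) (auto simp: a_def)
      also have "\<dots> \<le> max 1 (?N powr (q1 * (p - 2) / (2 * p))) * ?u"
        unfolding a_def using assms by (intro norm_powr_le_entry_lp_norm)
      also have "\<dots> \<le> ?M * ?u" by (intro mult_right_mono) auto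
      finally have A: "sqrt (a Y) \<le> ?M * ?u" .
      have rr: "(?r * ?r) powr (q2 * (p - 2) / (2 * p)) = ?r powr (q2 * (p - 2) / p)"
        by (simp add: powr_mult flip: powr_add)
      have "sqrt (b Y) \<le> b Y powr q2"
        using le1 assms by (intro sqrt_le_powr) (auto simp: b_def)
      also have "\<dots> \<le> max 1 (?r powr (q2 * (p - 2) / p)) * ?v"
        unfolding b_def rr[symmetric] using assms by (intro norm_powr_le_entry_lp_norm)
      also have "\<dots> \<le> ?M * ?v" by (intro mult_right_mono) auto
      finally have B: "sqrt (b Y) \<le> ?M * ?v" .
      have "L * h Y \<le> L * (4 * sqrt ?r * (?M * ?u + ?M * ?v))"
        unfolding h_def using A B L by (intro mult_left_mono add_mono) auto
      also have "\<dots> = (4 * L * sqrt ?r * ?M) * (?u + ?v)" by (simp add: algebra_simps)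
      also have "\<dots> \<le> \<mu> * (?u + ?v)" using \<mu> by (intro mult_right_mono) auto
      finally show ?thesis .
    qed
    finally show ?thesis unfolding penalized_eq_on_stiefel[OF X] by (simp add: penalized_def)
  qed
  then show "local_minimizer_on (penalized F p q1 q2 \<mu>) S X"
    using X assms(2) \<delta> by (auto simp: local_minimizer_on_def)
next
  fix X :: "real ^ 'r ^ 'n"
  assume X: "X \<in> nonneg_stiefel"
    and "\<exists>\<mu>>0. local_minimizer_on (penalized F p q1 q2 \<mu>) S X"
  then obtain \<mu> where "local_minimizer_on (penalized F p q1 q2 \<mu>) S X" by blast
  then obtain e where e: "0 < e"
    and min: "\<And>Y. Y \<in> S \<Longrightarrow> dist X Y < e \<Longrightarrow> penalized F p q1 q2 \<mu> X \<le> penalized F p q1 q2 \<mu> Y"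
    unfolding local_minimizer_on_def by (auto simp: mem_ball Ball_def)
  have "F X \<le> F Y" if "Y \<in> nonneg_stiefel" "dist X Y < e" for Y
    using min[of Y] that assms(2) by (auto simp: penalized_eq_on_stiefel X)
  then show "local_minimizer_on F nonneg_stiefel X"
    using X e by (auto simp: local_minimizer_on_def)
qed

end
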